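(* Let $\{x_k\}_{k\ge0}$ be a sequence of nonnegative numbers infinitely many of which are positive, with generating function $f(z)=\sum_{k\ge0}x_kz^k$ of convergence radius $\sigma$. Suppose that $f$ is meromorphic in an open set containing $\{z\in\mathbb C:|z|\le\sigma\}$, that $z=\sigma$ is a pole of $f$ of finite order $\breve m\ge1$, and that $f$ has exactly $P\ge1$ dominant poles $\sigma_0,\dots,\sigma_{P-1}$, where $\sigma_0=\sigma$ and $0=\arg\sigma_0<\arg\sigma_1<\cdots<\arg\sigma_{P-1}<2\pi$. Let $a_{1,k}=(\sigma+\varepsilon_0)^{-k}$ for a sufficiently small $\varepsilon_0>0$, and $a_{m,k}=k^{m-2}/\sigma^k$ for $m\ge2$. Then: (a) $x_k=\binom{k+\breve m-1}{\breve m-1}\sigma^{-k}\xi_k+O(a_{\breve m,k})=\frac{k^{\breve m-1}}{(\breve m-1)!}\sigma^{-k}\xi_k+O(a_{\breve m,k})$ as $k\to\infty$, where $\xi_k=\sum_{j=0}^{P-1}(\sigma/\sigma_j)^k\lim_{z\to\sigma_j}(1-z/\sigma_j)^{\breve m}f(z)$; (b) $\limsup_{k\to\infty}\xi_k>0$; (c) $\xi_k\ge0$ for all $k\ge0$; (d) if in addition $\{x_k\}$ is eventually nonincreasing and $(\arg\sigma_j)/\pi$ is rational for every $j=0,\dots,P-1$, then $\xi_k>0$ for all $k\ge0$.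
   Context: A dominant pole of $f$ is a pole of $f$ lying on the circle $\{|z|=\sigma\}$ whose order equals $\breve m$, the order of the pole at $z=\sigma$. The convergence radius is $\sigma=\sup\{|z|:\sum_k x_kz^k<\infty\}$. *)

theory Defs
  imports "HOL-Complex_Analysis.Complex_Analysis" "HOL-Library.Landau_Symbols"
begin

definition arg0 :: "complex \<Rightarrow> real" where
  "arg0 z = (if 0 \<le> Arg z then Arg z else Arg z + 2 * pi)"

(* dominant pole: a pole on the circle |z| = sigma whose order equals mb,
   the order of the pole at z = sigma *)
definition dominant_pole :: "(complex \<Rightarrow> complex) \<Rightarrow> real \<Rightarrow> nat \<Rightarrow> complex \<Rightarrow> bool" where
  "dominant_pole F \<sigma> mb z \<longleftrightarrow> norm z = \<sigma> \<and> is_pole F z \<and> zorder F z = - int mb"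

definition a_seq :: "real \<Rightarrow> real \<Rightarrow> nat \<Rightarrow> nat \<Rightarrow> real" where
  "a_seq \<epsilon>0 \<sigma> m k = (if m = 1 then 1 / (\<sigma> + \<epsilon>0) ^ k else real k ^ (m - 2) / \<sigma> ^ k)"

definition xi :: "(complex \<Rightarrow> complex) \<Rightarrow> real \<Rightarrow> (nat \<Rightarrow> complex) \<Rightarrow> nat \<Rightarrow> nat \<Rightarrow> nat \<Rightarrow> complex" where
  "xi F \<sigma> s P mb k =
     (\<Sum>j<P. (complex_of_real \<sigma> / s j) ^ k * Lim (at (s j)) (\<lambda>z. (1 - z / s j) ^ mb * F z))"

end

theory Submission
  imports Defs "HOL-Real_Asymp.Real_Asymp"
begin

text \<open>
  Nonnegativity of the coefficients gives \<open>\<bar>F (t p)\<bar> \<le> F (t \<sigma>)\<close> for \<open>\<bar>p\<bar> = \<sigma>\<close> and \<open>0 < t < 1\<close>, so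
  every pole on the circle has order at most that of \<open>\<sigma>\<close>. Subtracting the principal parts at these
  finitely many poles leaves a function holomorphic in a larger disc, and comparing coefficients
  gives (a): the leading terms of the principal parts make up \<open>\<xi>\<close>, and the others are of lower order.

  For the rest, \<open>\<xi>\<close> is a finite sum of powers of unit complex numbers, so Dirichlet's approximation
  theorem yields \<open>r i \<rightarrow> \<infinity>\<close> with \<open>\<xi> (k + r i) \<rightarrow> \<xi> k\<close> for every \<open>k\<close>. Hence each \<open>\<xi> k\<close> is a limit of
  normalised coefficients, which is (c). If the limsup vanished, then \<open>\<xi>\<close> would vanish
  identically, contradicting the nonzero mean contributed by the pole at \<open>\<sigma>\<close>; this is (b).
  In (d), monotonicity propagates a zero of \<open>\<xi>\<close> from \<open>k\<close> to \<open>k + 1\<close> along the same sequence \<open>r\<close>,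
  which contradicts (b).
\<close>

section \<open>Sums of powers of unit complex numbers\<close>

text \<open>Dirichlet's simultaneous approximation brings a common multiple of all angles close to
  whole turns, and a chord of the unit circle is no longer than the angle it spans.\<close>

lemma unit_powers_simultaneously_near_one:
  fixes u :: "nat \<Rightarrow> complex"
  assumes unit: "\<And>j. j < n \<Longrightarrow> norm (u j) = 1" and "e > 0"
  obtains q where "q \<ge> N" "\<And>j. j < n \<Longrightarrow> norm (u j ^ q - 1) < e"
proof -
  \<comment> \<open>Dirichlet's theorem yields only some positive \<open>q\<close>. Scaling the
    angles, measured in turns, by \<open>M\<close> beforehand allows the exponent
    \<open>M * nat q\<close>, which is at least \<open>N\<close>.\<close>
  define M where "M = Suc N"
  define \<theta> where "\<theta> = (\<lambda>j. real M * Arg (u j) / (2 * pi))"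
  \<comment> \<open>An error below \<open>1 / K\<close> turns is an angle below
    \<open>2 * pi / K\<close>, hence below \<open>e\<close>.\<close>
  obtain K :: nat where K: "2 * pi / e < real K"
    using reals_Archimedean2 by blast
  have "K > 0"
    using K \<open>e > 0\<close> by (cases K) (auto simp: divide_less_0_iff pi_gt_zero less_imp_le not_less)
  obtain q p where qp: "0 < q" "\<And>j. j < n \<Longrightarrow> \<bar>of_int q * \<theta> j - of_int (p j)\<bar> < 1 / K"
    using Dirichlet_approx_simult[OF \<open>K > 0\<close>, of n \<theta>] by metis
  show ?thesis
  proof (rule that[of "M * nat q"])
    have "1 \<le> nat q"
      using qp(1) by simp
    hence "M * 1 \<le> M * nat q"
      by (rule mult_le_mono2)
    thus "N \<le> M * nat q"
      by (simp add: M_def)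
  next
    fix j assume j: "j < n"
    define y where "y = of_int q * \<theta> j - of_int (p j)"
    have u: "u j = cis (Arg (u j))"
      using unit[OF j] cis_Arg[of "u j"] by (metis norm_zero sgn_eq zero_neq_one div_by_1 of_real_1)
    have "u j ^ (M * nat q) = cis (real (M * nat q) * Arg (u j))"
      by (subst u) (simp only: Complex.DeMoivre)
    also have "real (M * nat q) * Arg (u j) = 2 * pi * y + 2 * pi * of_int (p j)"
      using qp(1) by (simp add: y_def \<theta>_def field_simps)
    also have "cis \<dots> = cis (2 * pi * y)"
      by (simp add: cis_mult[symmetric])
    finally have "norm (u j ^ (M * nat q) - 1) = dist (cis (2 * pi * y)) (cis 0)"
      by (simp add: dist_norm)
    also have "\<dots> \<le> \<bar>2 * pi * y\<bar>"
    proof -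
      have "dist (cis t) (cis 0) \<le> \<bar>t\<bar>" for t
        using dist_exp_i_1[of t] abs_sin_x_le_abs_x[of "t / 2"] by (simp add: dist_norm cis_conv_exp)
      thus ?thesis .
    qed
    also have "\<dots> < 2 * pi * (1 / K)"
      using mult_strict_left_mono[OF qp(2)[OF j], of "2 * pi"] by (simp add: abs_mult y_def)
    also have "\<dots> < e"
      using K \<open>K > 0\<close> \<open>e > 0\<close> by (simp add: field_simps)
    finally show "norm (u j ^ (M * nat q) - 1) < e" .
  qed
qed

text \<open>Exponents \<open>r i \<ge> i\<close> are chosen with every \<open>u j ^ r i\<close>
  within \<open>1 / (i + 1)\<close> of 1. Since \<open>u j ^ (k + r i)\<close> factors, one sequence
  \<open>r\<close> serves all \<open>k\<close>.\<close>

lemma unit_exponential_sum_recurrent: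
  fixes u c :: "nat \<Rightarrow> complex"
  assumes unit: "\<And>j. j < n \<Longrightarrow> norm (u j) = 1"
  obtains r :: "nat \<Rightarrow> nat" where "filterlim r at_top sequentially"
    "\<And>k. (\<lambda>i. \<Sum>j<n. u j ^ (k + r i) * c j) \<longlonglongrightarrow> (\<Sum>j<n. u j ^ k * c j)"
proof -
  have "\<exists>q\<ge>i. \<forall>j<n. norm (u j ^ q - 1) < inverse (real (Suc i))" for i
    using unit_powers_simultaneously_near_one[of n u "inverse (real (Suc i))" i, OF unit]
    by (metis inverse_positive_iff_positive of_nat_0_less_iff zero_less_Suc)
  then obtain r where r: "\<And>i. r i \<ge> i" "\<And>i j. j < n \<Longrightarrow> norm (u j ^ r i - 1) < inverse (real (Suc i))"
    by metis
  have lim1: "(\<lambda>i. u j ^ r i) \<longlonglongrightarrow> 1" if "j < n" for j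
  proof -
    have "(\<lambda>i. u j ^ r i - 1) \<longlonglongrightarrow> 0"
      by (rule Lim_null_comparison[OF _ LIMSEQ_inverse_real_of_nat])
         (intro always_eventually allI less_imp_le r(2) that)
    thus ?thesis
      using LIM_zero_iff by blast
  qed
  show ?thesis
  proof (rule that)
    show "filterlim r at_top sequentially"
      by (rule filterlim_at_top_mono[OF filterlim_ident]) (simp add: r(1))
  next
    fix k
    have "(\<lambda>i. \<Sum>j<n. u j ^ k * u j ^ r i * c j) \<longlonglongrightarrow> (\<Sum>j<n. u j ^ k * 1 * c j)"
      by (intro tendsto_intros lim1) auto
    thus "(\<lambda>i. \<Sum>j<n. u j ^ (k + r i) * c j) \<longlonglongrightarrow> (\<Sum>j<n. u j ^ k * c j)"
      by (simp add: power_add)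
  qed
qed

text \<open>Sum over \<open>k < N\<close>: geometric sums with ratio \<open>u j \<noteq> 1\<close>
  are bounded uniformly in \<open>N\<close>, whereas the term at index 0 contributes
  \<open>N * c 0\<close>.\<close>

lemma unit_exponential_sum_zero_imp_mean_zero:
  fixes u c :: "nat \<Rightarrow> complex"
  assumes unit: "\<And>j. j < n \<Longrightarrow> norm (u j) = 1" and "n \<ge> 1"
    and u0: "u 0 = 1" and u_neq: "\<And>j. 0 < j \<Longrightarrow> j < n \<Longrightarrow> u j \<noteq> 1"
    and zero: "\<And>k. (\<Sum>j<n. u j ^ k * c j) = 0"
  shows "c 0 = 0"
proof (rule ccontr)
  assume nz: "c 0 \<noteq> 0"
  define B where "B = (\<Sum>j=1..<n. 2 / norm (1 - u j) * norm (c j))"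
  have bound: "real N * norm (c 0) \<le> B" for N
  proof -
    have split: "{..<n} = insert 0 {1..<n}"
      using \<open>n \<ge> 1\<close> by auto
    have "0 = (\<Sum>k<N. \<Sum>j<n. u j ^ k * c j)"
      by (simp add: zero)
    also have "\<dots> = (\<Sum>j<n. (\<Sum>k<N. u j ^ k) * c j)"
      by (subst sum.swap) (simp add: sum_distrib_right)
    also have "\<dots> = of_nat N * c 0 + (\<Sum>j=1..<n. (\<Sum>k<N. u j ^ k) * c j)"
      by (simp add: split u0)
    finally have "of_nat N * c 0 = - (\<Sum>j=1..<n. (\<Sum>k<N. u j ^ k) * c j)"
      by (simp add: eq_neg_iff_add_eq_0)
    hence "real N * norm (c 0) = norm (\<Sum>j=1..<n. (\<Sum>k<N. u j ^ k) * c j)"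
      by (metis norm_minus_cancel norm_mult norm_of_nat)
    also have "\<dots> \<le> B"
      unfolding B_def
    proof (rule sum_norm_le)
      fix j assume j: "j \<in> {1..<n}"
      have "norm (\<Sum>k<N. u j ^ k) = norm (1 - u j ^ N) / norm (1 - u j)"
        using u_neq[of j] j by (simp add: sum_gp_strict norm_divide)
      also have "\<dots> \<le> 2 / norm (1 - u j)"
        using norm_triangle_ineq4[of 1 "u j ^ N"] unit[of j] j
        by (intro divide_right_mono) (auto simp: norm_power)
      finally show "norm ((\<Sum>k<N. u j ^ k) * c j) \<le> 2 / norm (1 - u j) * norm (c j)"
        unfolding norm_mult by (rule mult_right_mono) simp
    qed
    finally show ?thesis .
  qed
  obtain N :: nat where "B / norm (c 0) < real N"
    using reals_Archimedean2 by blast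
  with bound[of N] nz show False
    by (simp add: field_simps)
qed

text \<open>The three conclusions rest on one recurrence sequence \<open>r\<close>. They are
  detached from the generating function: it suffices that nonnegative normalised coefficients
  approach \<open>\<xi> k / a\<close>. Monotonicity is a premise of the last conclusion
  only.\<close>

lemma
  fixes x :: "nat \<Rightarrow> real" and u c :: "nat \<Rightarrow> complex" and \<sigma> a :: real and n m :: nat
  defines "\<xi> \<equiv> \<lambda>k. \<Sum>j<n. u j ^ k * c j"
  assumes unit: "\<And>j. j < n \<Longrightarrow> norm (u j) = 1" and "n \<ge> 1"
    and u0: "u 0 = 1" and u_neq: "\<And>j. 0 < j \<Longrightarrow> j < n \<Longrightarrow> u j \<noteq> 1" and c0: "c 0 \<noteq> 0"
    and nonneg: "\<And>k. x k \<ge> 0" and \<sigma>: "\<sigma> > 0" and a: "a > 0"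
    and asymp: "(\<lambda>k. complex_of_real (x k * \<sigma> ^ k / real k ^ m) - \<xi> k / of_real a) \<longlonglongrightarrow> 0"
  shows unit_exponential_sum_nonneg: "\<xi> k \<in> \<real> \<and> Re (\<xi> k) \<ge> 0"
    and unit_exponential_sum_limsup_pos: "limsup (\<lambda>k. ereal (Re (\<xi> k))) > 0"
    and unit_exponential_sum_pos:
      "\<forall>\<^sub>F k in sequentially. x (Suc k) \<le> x k \<Longrightarrow> Re (\<xi> k) > 0"
proof -
  define y where "y = (\<lambda>k. x k * \<sigma> ^ k / real k ^ m)"
  have y_nonneg: "y k \<ge> 0" for k
    using nonneg \<sigma> by (simp add: y_def)
  obtain r where r: "filterlim r at_top sequentially"
    and rec: "\<And>k. (\<lambda>i. \<xi> (k + r i)) \<longlonglongrightarrow> \<xi> k"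
    using unit_exponential_sum_recurrent[of n u c, OF unit] unfolding \<xi>_def by blast
  have shift: "filterlim (\<lambda>i. k + r i) sequentially sequentially" for k
    using r by (rule filterlim_at_top_mono) auto
  \<comment> \<open>Along \<open>k + r i\<close> the asymptotic error vanishes while
    \<open>\<xi>\<close> returns to \<open>\<xi> k\<close>, so each single value of
    \<open>\<xi>\<close> is visible in the limit of the coefficients.\<close>
  have ylim: "(\<lambda>i. complex_of_real (y (k + r i))) \<longlonglongrightarrow> \<xi> k / of_real a" for k
  proof -
    have "(\<lambda>i. (complex_of_real (y (k + r i)) - \<xi> (k + r i) / of_real a) + \<xi> (k + r i) / of_real a)
            \<longlonglongrightarrow> 0 + \<xi> k / of_real a"
      using filterlim_compose[OF asymp shift[of k]] a
      by (intro tendsto_intros rec) (auto simp: y_def)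
    thus ?thesis
      by simp
  qed
  have nonneg_real: "\<xi> k \<in> \<real> \<and> Re (\<xi> k) \<ge> 0" for k
  proof -
    have "\<xi> k / of_real a \<in> \<real>\<^sub>\<ge>\<^sub>0"
      by (rule Lim_in_closed_set[OF closed_nonneg_Reals_complex _ _ ylim]) (use y_nonneg in auto)
    thus ?thesis
      using a by (simp add: complex_nonneg_Reals_iff complex_is_Real_iff zero_le_divide_iff)
  qed
  have limsup_pos: "limsup (\<lambda>k. ereal (Re (\<xi> k))) > 0"
  proof (rule ccontr)
    assume "\<not> ?thesis"
    hence le: "limsup (\<lambda>k. ereal (Re (\<xi> k))) \<le> 0"
      by simp
    have "\<xi> k = 0" for k
    proof -
      \<comment> \<open>Recurrence turns an eventual upper bound on \<open>\<xi>\<close> into a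
        bound at every fixed index.\<close>
      have "Re (\<xi> k) \<le> e" if "e > 0" for e
      proof (rule tendsto_upperbound[OF tendsto_Re[OF rec[of k]]])
        have "limsup (\<lambda>k. ereal (Re (\<xi> k))) < ereal e"
          using le that by (meson ereal_less(2) order.strict_trans1)
        hence "\<forall>\<^sub>F j in sequentially. ereal (Re (\<xi> j)) < ereal e"
          by (rule Limsup_lessD)
        from eventually_compose_filterlim[OF this shift[of k]]
        show "\<forall>\<^sub>F i in sequentially. Re (\<xi> (k + r i)) \<le> e"
          by eventually_elim simp
      qed auto
      hence "Re (\<xi> k) \<le> 0"
        by (rule field_le_epsilon) auto
      thus ?thesis
        using nonneg_real[of k] by (auto simp: complex_eq_iff complex_is_Real_iff)
    qed
    with unit_exponential_sum_zero_imp_mean_zero[of n u c, OF unit \<open>n \<ge> 1\<close> u0 u_neq] c0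
    show False
      by (simp add: \<xi>_def)
  qed
  show "\<xi> k \<in> \<real> \<and> Re (\<xi> k) \<ge> 0"
    by (rule nonneg_real)
  show "limsup (\<lambda>k. ereal (Re (\<xi> k))) > 0"
    by (rule limsup_pos)
  assume decr: "\<forall>\<^sub>F k in sequentially. x (Suc k) \<le> x k"
  show "Re (\<xi> k) > 0"
  proof (rule ccontr)
    assume "\<not> ?thesis"
    hence zero: "\<xi> k = 0"
      using nonneg_real[of k] by (auto simp: complex_eq_iff complex_is_Real_iff)
    have step: "\<xi> (Suc l) = 0" if "\<xi> l = 0" for l
    proof -
      \<comment> \<open>Replacing \<open>x (Suc j)\<close> by \<open>x j\<close> and the denominator
        by the smaller \<open>real j ^ m\<close> costs only the extra factor
        \<open>\<sigma>\<close>; \<open>j > 0\<close> keeps the denominator positive.\<close>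
      have "\<forall>\<^sub>F j in sequentially. y (Suc j) \<le> \<sigma> * y j"
        using decr eventually_gt_at_top[of 0]
      proof eventually_elim
        case (elim j)
        have "y (Suc j) \<le> x j * \<sigma> ^ Suc j / real j ^ m"
          unfolding y_def using elim \<sigma> nonneg
          by (intro frac_le mult_right_mono power_mono) auto
        thus ?case
          by (simp add: y_def mult_ac)
      qed
      hence ev: "\<forall>\<^sub>F i in sequentially. y (Suc (l + r i)) \<le> \<sigma> * y (l + r i)"
        by (rule eventually_compose_filterlim[OF _ shift[of l]])
      have "(\<lambda>i. y (l + r i)) \<longlonglongrightarrow> 0"
        using tendsto_Re[OF ylim[of l]] that by simp
      hence "(\<lambda>i. \<sigma> * y (l + r i)) \<longlonglongrightarrow> 0"
        by (rule tendsto_mult_right_zero)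
      hence "(\<lambda>i. y (Suc (l + r i))) \<longlonglongrightarrow> 0"
        by (intro tendsto_sandwich[OF _ ev tendsto_const]) (simp add: y_nonneg)
      hence "(\<lambda>i. complex_of_real (y (Suc l + r i))) \<longlonglongrightarrow> 0"
        using tendsto_of_real by fastforce
      with ylim[of "Suc l"] have "\<xi> (Suc l) / of_real a = 0"
        using LIMSEQ_unique by blast
      thus ?thesis
        using a by simp
    qed
    have "\<xi> l = 0" if "l \<ge> k" for l
      using that by (induction rule: dec_induct) (auto simp: zero step)
    hence "\<forall>\<^sub>F l in sequentially. ereal (Re (\<xi> l)) = 0"
      unfolding eventually_sequentially by (metis zero_complex.sel(1) zero_ereal_def)
    hence "(\<lambda>l. ereal (Re (\<xi> l))) \<longlonglongrightarrow> 0"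
      by (rule tendsto_eventually)
    hence "limsup (\<lambda>l. ereal (Re (\<xi> l))) = 0"
      by (rule lim_imp_Limsup[OF trivial_limit_sequentially])
    with limsup_pos show False
      by simp
  qed
qed

section \<open>Principal parts and coefficients\<close>

text \<open>The quotient has the finite limit \<open>- p * deriv h p\<close> at \<open>p\<close>, so
  its singularity is removable. The factor \<open>1 - z / p\<close> is used in place of
  \<open>z - p\<close> to match the limits in \<open>xi\<close>.\<close>

lemma analytic_divided_difference:
  fixes h :: "complex \<Rightarrow> complex"
  assumes "h analytic_on {p}" "p \<noteq> 0"
  obtains q where "q analytic_on {p}" "\<forall>\<^sub>F z in at p. h z = h p + (1 - z / p) * q z"
proof -
  define d where "d = (\<lambda>z. (h z - h p) / (1 - z / p))"
  have "d meromorphic_on {p}"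
    unfolding d_def using assms by (intro meromorphic_intros analytic_on_imp_meromorphic_on)
  hence iso: "isolated_singularity_at d p"
    by (rule meromorphic_on_isolated_singularity)
  have "(h has_field_derivative deriv h p) (at p)"
    using assms(1) analytic_on_imp_differentiable_at DERIV_deriv_iff_field_differentiable by blast
  hence "((\<lambda>z. (h z - h p) / (z - p)) \<longlongrightarrow> deriv h p) (at p)"
    by (simp add: has_field_derivative_iff)
  hence "((\<lambda>z. - p * ((h z - h p) / (z - p))) \<longlongrightarrow> - p * deriv h p) (at p)"
    by (intro tendsto_intros)
  moreover have "- p * ((h z - h p) / (z - p)) = d z" for z
  proof -
    have "d z = (h z - h p) / ((z - p) / (- p))"
      using assms(2) by (simp add: d_def diff_divide_distrib)
    thus ?thesis
      by simp
  qed
  ultimately have "d \<midarrow>p\<rightarrow> - p * deriv h p"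
    by simp
  from remove_sings_analytic_at[OF iso this] have an: "remove_sings d analytic_on {p}" .
  show ?thesis
  proof (rule that[OF an])
    have "\<forall>\<^sub>F z in at p. z \<noteq> p"
      by (simp add: eventually_at_filter)
    with eventually_remove_sings_eq_at[OF iso]
    show "\<forall>\<^sub>F z in at p. h z = h p + (1 - z / p) * remove_sings d z"
      by eventually_elim (use assms(2) in \<open>auto simp: d_def\<close>)
  qed
qed

text \<open>Induction on \<open>m\<close>: the divided difference splits off the top term and lowers
  the power by one, with the quotient in the role of \<open>h\<close>. Index \<open>i\<close>
  belongs to order \<open>i + 1\<close>, so \<open>c m\<close> is the leading coefficient.\<close>

lemma analytic_over_power_partial_fraction:
  fixes h :: "complex \<Rightarrow> complex"
  assumes "h analytic_on {p}" "p \<noteq> 0"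
  shows "\<exists>c q. q analytic_on {p} \<and> c m = h p \<and>
    (\<forall>\<^sub>F z in at p. h z / (1 - z / p) ^ Suc m = (\<Sum>i\<le>m. c i / (1 - z / p) ^ Suc i) + q z)"
  using assms(1)
proof (induction m arbitrary: h)
  case 0
  obtain q where q: "q analytic_on {p}" "\<forall>\<^sub>F z in at p. h z = h p + (1 - z / p) * q z"
    using analytic_divided_difference[OF 0 assms(2)] .
  have "\<forall>\<^sub>F z in at p. z \<noteq> p"
    by (simp add: eventually_at_filter)
  with q(2) have "\<forall>\<^sub>F z in at p. h z / (1 - z / p) ^ Suc 0 = (\<Sum>i\<le>0. h p / (1 - z / p) ^ Suc i) + q z"
    by eventually_elim (use assms(2) in \<open>auto simp: add_divide_distrib\<close>)
  thus ?case
    by (intro exI[of _ "\<lambda>_. h p"] exI[of _ q]) (use q(1) in auto)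
next
  case (Suc m)
  obtain g where g: "g analytic_on {p}" "\<forall>\<^sub>F z in at p. h z = h p + (1 - z / p) * g z"
    using analytic_divided_difference[OF Suc.prems assms(2)] .
  obtain c q where q: "q analytic_on {p}"
    "\<forall>\<^sub>F z in at p. g z / (1 - z / p) ^ Suc m = (\<Sum>i\<le>m. c i / (1 - z / p) ^ Suc i) + q z"
    using Suc.IH[OF g(1)] by blast
  define c' where "c' = c(Suc m := h p)"
  have "\<forall>\<^sub>F z in at p. z \<noteq> p"
    by (simp add: eventually_at_filter)
  with g(2) q(2)
  have "\<forall>\<^sub>F z in at p. h z / (1 - z / p) ^ Suc (Suc m) = (\<Sum>i\<le>Suc m. c' i / (1 - z / p) ^ Suc i) + q z"
  proof eventually_elim
    case (elim z)
    have nz: "1 - z / p \<noteq> 0"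
      using elim(3) assms(2) by auto
    have "h z / (1 - z / p) ^ Suc (Suc m) = h p / (1 - z / p) ^ Suc (Suc m) + g z / (1 - z / p) ^ Suc m"
      using nz by (subst elim(1)) (simp add: add_divide_distrib)
    also have "g z / (1 - z / p) ^ Suc m = (\<Sum>i\<le>m. c' i / (1 - z / p) ^ Suc i) + q z"
      by (simp only: elim(2)) (simp add: c'_def)
    finally show ?case
      by (simp add: c'_def)
  qed
  thus ?case
    by (intro exI[of _ c'] exI[of _ q]) (use q(1) in \<open>auto simp: c'_def\<close>)
qed

text \<open>This is the negative binomial series. The sign produced by
  \<open>gbinomial_minus\<close> cancels that of \<open>(- w) ^ k\<close>.\<close>

lemma sums_inverse_one_minus_power:
  fixes w :: complex
  assumes "norm w < 1"
  shows "(\<lambda>k. of_nat ((k + i) choose i) * w ^ k) sums (1 / (1 - w) ^ Suc i)"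
proof -
  have "(\<lambda>k. ((- of_nat (Suc i)) gchoose k) * (- w) ^ k) sums (1 + (- w)) powr (- of_nat (Suc i))"
    using assms by (intro gen_binomial_complex) auto
  also have "(1 + (- w)) powr (- of_nat (Suc i)) = 1 / (1 - w) ^ Suc i"
    using assms by (subst powr_minus, subst powr_nat') (auto simp: field_simps)
  also have "(\<lambda>k. ((- of_nat (Suc i)) gchoose k) * (- w) ^ k) =
             (\<lambda>k. of_nat ((k + i) choose i) * w ^ k)"
  proof
    fix k
    have "(of_nat (Suc i) + of_nat k - 1 :: complex) gchoose k = of_nat ((k + i) choose k)"
      by (simp add: binomial_gbinomial add_ac)
    thus "((- of_nat (Suc i)) gchoose k) * (- w) ^ k = of_nat ((k + i) choose i) * w ^ k"
      using binomial_symmetric[of k "k + i"]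
      by (simp only: gbinomial_minus) (simp add: power_minus' mult_ac)
  qed
  finally show ?thesis .
qed

text \<open>A nonzero coefficient of positive index would isolate the zero of the sum at 0, which is
  absurd for the zero function. Evaluation at 0 settles the constant coefficient.\<close>

lemma powser_sums_0_imp_coeffs_0:
  fixes a :: "nat \<Rightarrow> 'a::{real_normed_field,banach}"
  assumes "r > 0" and sums: "\<And>z. norm z < r \<Longrightarrow> (\<lambda>n. a n * z ^ n) sums 0"
  shows "a n = 0"
proof (rule ccontr)
  assume nz: "a n \<noteq> 0"
  have "a 0 = 0"
    using sums[of 0] assms(1) by simp
  with nz have "n > 0"
    by (cases n) auto
  obtain s where s: "s > 0" "\<And>z. z \<in> cball 0 s - {0} \<Longrightarrow> (\<lambda>_::'a. 0::'a) z \<noteq> 0"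
    using powser_0_nonzero[of r 0 a "\<lambda>_. 0" n] assms nz \<open>n > 0\<close> by auto
  show False
    using s(2)[of "of_real s"] s(1) by auto
qed

text \<open>Limits at a boundary point become limits along its radius, where the power series is
  available.\<close>

lemma filterlim_radial:
  fixes p :: complex
  assumes "p \<noteq> 0"
  shows "filterlim (\<lambda>t. of_real t * p) (at p) (at_left (1::real))"
proof -
  have "((\<lambda>t::real. of_real t * p) \<longlongrightarrow> of_real 1 * p) (at_left 1)"
    by (intro tendsto_intros)
  moreover have "\<forall>\<^sub>F t::real in at_left 1. of_real t * p \<noteq> p"
    using eventually_at_left_real[of 0 "1::real", OF zero_less_one] by eventually_elim (use assms in auto)
  ultimately show ?thesis
    by (simp add: filterlim_at)
qed

text \<open>Termwise comparison bounds \<open>F\<close> at \<open>t * p\<close> by its value at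
  \<open>t * \<sigma>\<close>, and the factor \<open>(1 - t) ^ m\<close> is the same at both. The
  product at \<open>\<sigma>\<close> converges, so the one at \<open>p\<close> cannot blow up; being
  meromorphic without a pole, it has a limit.\<close>

lemma nonneg_powser_singularity_order_le:
  fixes x :: "nat \<Rightarrow> real" and F :: "complex \<Rightarrow> complex"
  assumes nonneg: "\<And>k. x k \<ge> 0" and \<sigma>: "\<sigma> > 0"
    and sums: "\<And>z. norm z < \<sigma> \<Longrightarrow> (\<lambda>k. of_real (x k) * z ^ k) sums F z"
    and lim: "(\<lambda>z. (1 - z / of_real \<sigma>) ^ m * F z) \<midarrow>of_real \<sigma>\<rightarrow> L"
    and p: "norm p = \<sigma>" and merom: "F meromorphic_on {p}"
  shows "\<exists>c. (\<lambda>z. (1 - z / p) ^ m * F z) \<midarrow>p\<rightarrow> c"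
proof -
  define K where "K = (\<lambda>z. (1 - z / p) ^ m * F z)"
  have "p \<noteq> 0"
    using p \<sigma> by auto
  have "K meromorphic_on {p}"
    unfolding K_def by (intro meromorphic_intros merom)
  hence "not_essential K p"
    by (rule meromorphic_on_not_essential)
  moreover have "\<not> is_pole K p"
  proof
    assume "is_pole K p"
    hence lim_K: "filterlim K at_infinity (at p)"
      by (simp add: is_pole_def)
    have "filterlim (\<lambda>t. norm (K (of_real t * p))) at_top (at_left 1)"
      by (rule filterlim_compose[OF filterlim_at_infinity_imp_norm_at_top[OF lim_K] filterlim_radial[OF \<open>p \<noteq> 0\<close>]])
    hence "filterlim (\<lambda>t. norm ((1 - of_real t * of_real \<sigma> / of_real \<sigma>) ^ m * F (of_real t * of_real \<sigma>)))
             at_top (at_left 1)"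
    proof (rule filterlim_at_top_mono)
      show "\<forall>\<^sub>F t in at_left 1. norm (K (of_real t * p)) \<le>
              norm ((1 - of_real t * of_real \<sigma> / of_real \<sigma>) ^ m * F (of_real t * of_real \<sigma>))"
        using eventually_at_left_real[of 0 "1::real", OF zero_less_one]
      proof eventually_elim
        case (elim t)
        hence less: "norm (complex_of_real t * p) < \<sigma>" "norm (complex_of_real t * of_real \<sigma>) < \<sigma>"
          using p \<sigma> by (auto simp: norm_mult)
        have "norm (F (of_real t * p)) \<le> Re (F (of_real t * of_real \<sigma>))"
        proof (rule norm_sums_le[OF sums[OF less(1)] sums_Re[OF sums[OF less(2)]]])
          show "norm (of_real (x k) * (complex_of_real t * p) ^ k) \<le>
                Re (of_real (x k) * (complex_of_real t * of_real \<sigma>) ^ k)" for k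
            using elim nonneg p
            by (simp add: norm_mult norm_power flip: of_real_mult of_real_power)
        qed
        also have "\<dots> \<le> norm (F (of_real t * of_real \<sigma>))"
          by (rule complex_Re_le_cmod)
        finally show ?case
          using \<open>p \<noteq> 0\<close> \<sigma> by (simp add: K_def norm_mult norm_power mult_left_mono)
      qed
    qed
    moreover have "((\<lambda>t. norm ((1 - of_real t * of_real \<sigma> / of_real \<sigma>) ^ m * F (of_real t * of_real \<sigma>)))
             \<longlongrightarrow> norm L) (at_left (1::real))"
      using filterlim_compose[OF lim filterlim_radial] \<sigma> by (intro tendsto_norm) auto
    ultimately show False
      by (blast intro: not_tendsto_and_filterlim_at_infinity[OF trivial_limit_at_left_real]
                       filterlim_at_top_imp_at_infinity)
  qed
  ultimately show ?thesis
    by (auto simp: not_essential_def K_def)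
qed

text \<open>Compactness gives a uniform margin \<open>e\<close>, and a point at distance at most
  \<open>r + e\<close> from the centre lies within \<open>e\<close> of the smaller ball.\<close>

lemma open_superset_cball_enlarge:
  fixes V :: "'a::euclidean_space set"
  assumes "open V" "cball a r \<subseteq> V" "r \<ge> 0"
  obtains R where "R > r" "cball a R \<subseteq> V"
proof -
  obtain e where e: "e > 0" "(\<Union>x\<in>cball a r. cball x e) \<subseteq> V"
    using compact_subset_open_imp_cball_epsilon_subset[OF compact_cball assms(1,2)] by blast
  have "cball a (r + e) \<subseteq> V"
  proof
    fix z assume z: "z \<in> cball a (r + e)"
    show "z \<in> V"
    proof (cases "z \<in> cball a r")
      case True
      thus ?thesis using assms(2) by blast
    next
      case False
      define t where "t = r / dist a z"
      have d: "dist a z > r"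
        using False by simp
      have "dist a z > 0"
        using d assms(3) by linarith
      \<comment> \<open>\<open>w\<close> is the radial projection of \<open>z\<close> onto the
        sphere of radius \<open>r\<close>.\<close>
      define w where "w = a + t *\<^sub>R (z - a)"
      have dist_w: "dist a w = r"
        using \<open>dist a z > 0\<close> assms(3) by (simp add: w_def t_def dist_norm norm_minus_commute)
      have "z - w = (1 - t) *\<^sub>R (z - a)"
        by (simp add: w_def algebra_simps)
      hence "dist w z = \<bar>1 - t\<bar> * dist a z"
        by (metis dist_commute dist_norm norm_scaleR)
      also have "\<bar>1 - t\<bar> = (dist a z - r) / dist a z"
        using d \<open>dist a z > 0\<close> by (simp add: t_def abs_if field_simps)
      finally have "dist w z = dist a z - r"
        using \<open>dist a z > 0\<close> by simp
      hence "w \<in> cball a r" "z \<in> cball w e"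
        using z dist_w by auto
      thus ?thesis
        using e(2) by blast
    qed
  qed
  thus ?thesis
    using that[of "r + e"] e(1) by simp
qed

lemma holomorphic_coeffs_bound:
  assumes "f holomorphic_on cball 0 R" "R > 0"
  obtains B where "\<And>k. norm ((deriv ^^ k) f 0 / fact k) \<le> B / R ^ k"
proof -
  have cont: "continuous_on (cball 0 R) f"
    using assms(1) by (rule holomorphic_on_imp_continuous_on)
  then obtain B where B: "\<And>z. z \<in> cball 0 R \<Longrightarrow> norm (f z) \<le> B"
    using compact_imp_bounded[OF compact_continuous_image[OF cont compact_cball]]
    unfolding bounded_iff by fast
  have "norm ((deriv ^^ k) f 0) \<le> fact k * B / R ^ k" for k
    by (rule Cauchy_inequality[OF holomorphic_on_subset[OF assms(1) ball_subset_cball] cont assms(2)])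
       (use B in auto)
  hence "norm ((deriv ^^ k) f 0 / fact k) \<le> B / R ^ k" for k
    by (simp add: norm_divide field_simps)
  thus ?thesis
    by (rule that)
qed

text \<open>\<open>F\<close> minus its principal parts extends holomorphically to a disc of radius
  \<open>R > \<sigma>\<close>. The Taylor coefficients \<open>g\<close> of the extension satisfy
  Cauchy's bound, and the principal parts are expanded by the negative binomial series.\<close>

lemma coeffs_from_principal_parts:
  fixes F :: "complex \<Rightarrow> complex" and x :: "nat \<Rightarrow> complex" and c :: "complex \<Rightarrow> nat \<Rightarrow> complex"
  assumes \<sigma>: "\<sigma> > 0" and S: "finite S" "S \<subseteq> sphere 0 \<sigma>"
    and sums: "\<And>z. norm z < \<sigma> \<Longrightarrow> (\<lambda>k. x k * z ^ k) sums F z"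
    and an: "\<And>z. z \<in> cball 0 \<sigma> - S \<Longrightarrow> F analytic_on {z}"
    and q: "\<And>p. p \<in> S \<Longrightarrow> q p analytic_on {p}"
    and pp: "\<And>p. p \<in> S \<Longrightarrow> \<forall>\<^sub>F z in at p. F z = (\<Sum>i\<le>m. c p i / (1 - z / p) ^ Suc i) + q p z"
  shows "\<exists>R g B. R > \<sigma> \<and> (\<forall>k. norm (g k) \<le> B / R ^ k) \<and>
    (\<forall>k. x k = g k + (\<Sum>p\<in>S. \<Sum>i\<le>m. c p i * of_nat ((k + i) choose i) / p ^ k))"
proof -
  define T where "T = (\<lambda>p z. \<Sum>i\<le>m. c p i / (1 - z / p) ^ Suc i)"
  define G where "G = (\<lambda>z. F z - (\<Sum>p\<in>S. T p z))"
  \<comment> \<open>\<open>V\<close> is open and contains the closed disc of radius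
    \<open>\<sigma>\<close>, which is what provides the larger radius \<open>R\<close>.\<close>
  define V where "V = {z. remove_sings G analytic_on {z}}"
  have nz: "p \<noteq> 0" if "p \<in> S" for p
    using that S \<sigma> by auto
  have T_an: "T p analytic_on {z}" if "p \<in> S" "z \<noteq> p" for p z
    unfolding T_def using that nz[OF that(1)] by (intro analytic_intros) auto
  have G_an: "G analytic_on {z}" if "z \<in> cball 0 \<sigma> - S" for z
    unfolding G_def using that by (intro analytic_intros an T_an) auto
  have "cball 0 \<sigma> \<subseteq> V"
  proof
    fix z :: complex assume z: "z \<in> cball 0 \<sigma>"
    show "z \<in> V"
    proof (cases "z \<in> S")
      case False
      thus ?thesis
        using remove_sings_analytic_on[OF G_an] z by (simp add: V_def)
    next
      case True
      \<comment> \<open>Near \<open>z\<close> the principal part at \<open>z\<close> cancels,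
        leaving \<open>q z\<close> minus the principal parts at the other points, all analytic
        there.\<close>
      define H where "H = (\<lambda>w. q z w - (\<Sum>p\<in>S - {z}. T p w))"
      have H: "H analytic_on {z}"
        unfolding H_def by (intro analytic_intros q T_an True) auto
      have ev: "\<forall>\<^sub>F w in at z. H w = G w"
        using pp[OF True]
        by eventually_elim (simp add: G_def H_def sum.remove[OF S(1) True] T_def)
      have "isolated_singularity_at G z"
        using isolated_singularity_at_cong[OF ev refl] isolated_singularity_at_analytic[OF H] by simp
      moreover have "G \<midarrow>z\<rightarrow> H z"
        using analytic_at_imp_isCont[OF H] tendsto_cong[OF ev] by (simp add: isCont_def)
      ultimately show ?thesis
        using remove_sings_analytic_at by (simp add: V_def)
    qed
  qed
  moreover have "open V"
    unfolding open_contains_ball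
  proof
    fix z assume "z \<in> V"
    then obtain A where A: "open A" "z \<in> A" "remove_sings G holomorphic_on A"
      by (auto simp: V_def analytic_at)
    hence "A \<subseteq> V"
      by (auto simp: V_def analytic_at)
    thus "\<exists>e>0. ball z e \<subseteq> V"
      using A(1,2) open_contains_ball by (metis order.trans)
  qed
  ultimately obtain R where R: "R > \<sigma>" "cball 0 R \<subseteq> V"
    using open_superset_cball_enlarge[of V 0 \<sigma>] \<sigma> by auto
  have "remove_sings G analytic_on V"
    by (subst analytic_on_analytic_at) (simp add: V_def)
  hence hol: "remove_sings G holomorphic_on cball 0 R"
    using R(2) analytic_imp_holomorphic analytic_on_subset by blast
  define g where "g = (\<lambda>k. (deriv ^^ k) (remove_sings G) 0 / fact k)"
  obtain B where B: "\<And>k. norm (g k) \<le> B / R ^ k"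
    using holomorphic_coeffs_bound[OF hol] R(1) \<sigma> unfolding g_def by (metis order.strict_trans)
  \<comment> \<open>\<open>d\<close> is the defect in the claimed coefficient identity; its power
    series vanishes on the disc of radius \<open>\<sigma>\<close>.\<close>
  define d where "d = (\<lambda>k. x k - (g k + (\<Sum>p\<in>S. \<Sum>i\<le>m. c p i * of_nat ((k + i) choose i) / p ^ k)))"
  have "d k = 0" for k
  proof (rule powser_sums_0_imp_coeffs_0[OF \<sigma>])
    fix z :: complex assume z: "norm z < \<sigma>"
    have "(\<lambda>k. (deriv ^^ k) (remove_sings G) 0 / fact k * (z - 0) ^ k) sums remove_sings G z"
      by (rule holomorphic_power_series[of _ _ R])
         (use hol R(1) z in \<open>auto intro: holomorphic_on_subset\<close>)
    moreover have "remove_sings G z = G z"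
      using z S(2) by (intro remove_sings_at_analytic G_an) auto
    ultimately have g: "(\<lambda>k. g k * z ^ k) sums G z"
      by (simp add: g_def)
    have pp_sums: "(\<lambda>k. c p i * (of_nat ((k + i) choose i) * (z / p) ^ k)) sums (c p i / (1 - z / p) ^ Suc i)"
      if "p \<in> S" for p i
    proof -
      have "norm (z / p) < 1"
        using that S(2) z \<sigma> by (auto simp: norm_divide)
      from sums_mult[OF sums_inverse_one_minus_power[OF this], of "c p i" i] show ?thesis
        by simp
    qed
    have "(\<lambda>k. \<Sum>p\<in>S. \<Sum>i\<le>m. c p i * (of_nat ((k + i) choose i) * (z / p) ^ k)) sums (\<Sum>p\<in>S. T p z)"
      unfolding T_def by (intro sums_sum pp_sums)
    hence "(\<lambda>k. x k * z ^ k - (g k * z ^ k + (\<Sum>p\<in>S. \<Sum>i\<le>m. c p i * (of_nat ((k + i) choose i) * (z / p) ^ k))))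
             sums (F z - (G z + (\<Sum>p\<in>S. T p z)))"
      by (intro sums_diff sums_add sums z g)
    thus "(\<lambda>k. d k * z ^ k) sums 0"
      by (simp add: d_def G_def algebra_simps sum_distrib_left sum_distrib_right power_divide)
  qed
  thus ?thesis
    using R(1) B by (intro exI[of _ R] exI[of _ g] exI[of _ B]) (simp add: d_def)
qed

text \<open>The limit is the value of \<open>zor_poly\<close> at \<open>p\<close>, which is nonzero,
  times the factor \<open>(- 1 / p) ^ n\<close> that converts \<open>(z - p) ^ n\<close> into
  \<open>(1 - z / p) ^ n\<close>.\<close>

lemma pole_imp_tendsto_nonzero:
  fixes F :: "complex \<Rightarrow> complex"
  assumes merom: "F meromorphic_on {p}" and "is_pole F p" "zorder F p = - int n" "p \<noteq> 0"
  obtains L where "L \<noteq> 0" "(\<lambda>z. (1 - z / p) ^ n * F z) \<midarrow>p\<rightarrow> L"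
proof -
  obtain A where A: "open A" "p \<in> A" "F holomorphic_on A - {p}"
    using meromorphic_on_isolated_singularity[OF merom] analytic_imp_holomorphic
    by (auto simp: isolated_singularity_at_iff_analytic_nhd)
  define g where "g = zor_poly F p"
  obtain r where g: "g p \<noteq> 0" "r > 0" "g holomorphic_on cball p r"
    "\<And>w. w \<in> cball p r - {p} \<Longrightarrow> F w = g w / (w - p) ^ n"
    using zorder_exist_pole[OF A(3,1,2) assms(2)] assms(3) unfolding g_def by auto
  have "isCont g p"
    using g(2,3) by (meson centre_in_ball continuous_on_eq_continuous_at holomorphic_on_imp_continuous_on
        holomorphic_on_subset ball_subset_cball open_ball)
  hence "((\<lambda>z. (- 1 / p) ^ n * g z) \<longlongrightarrow> (- 1 / p) ^ n * g p) (at p)"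
    by (intro tendsto_intros) (simp add: isCont_def)
  moreover have "\<forall>\<^sub>F z in at p. z \<in> ball p r - {p}"
    using g(2) by (intro eventually_at_in_open) auto
  hence "\<forall>\<^sub>F z in at p. (- 1 / p) ^ n * g z = (1 - z / p) ^ n * F z"
  proof eventually_elim
    case (elim z)
    have "1 - z / p = (- 1 / p) * (z - p)"
      using \<open>p \<noteq> 0\<close> by (simp add: field_simps)
    hence "(1 - z / p) ^ n = (- 1 / p) ^ n * (z - p) ^ n"
      by (simp only: power_mult_distrib)
    thus ?case
      using g(4)[of z] elim by simp
  qed
  ultimately have "(\<lambda>z. (1 - z / p) ^ n * F z) \<midarrow>p\<rightarrow> (- 1 / p) ^ n * g p"
    by (rule Lim_transform_eventually)
  moreover have "(- 1 / p) ^ n * g p \<noteq> 0"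
    using g(1) \<open>p \<noteq> 0\<close> by simp
  ultimately show ?thesis
    using that by blast
qed

text \<open>A converse to \<open>pole_imp_tendsto_nonzero\<close>: after rescaling by
  \<open>(- p) ^ n\<close> the numerator is analytic and nonzero at \<open>p\<close>, which
  determines the order.\<close>

lemma pole_of_analytic_over_power:
  fixes F :: "complex \<Rightarrow> complex"
  assumes h: "h analytic_on {p}" "h p \<noteq> 0" and "p \<noteq> 0" "n > 0"
    and ev: "\<forall>\<^sub>F z in at p. F z = h z / (1 - z / p) ^ n"
  shows "is_pole F p" "zorder F p = - int n"
proof -
  define g where "g = (\<lambda>z. (- p) ^ n * h z)"
  have eq: "h z / (1 - z / p) ^ n = g z / (z - p) ^ n" for z
  proof -
    have "1 - z / p = (z - p) / (- p)"
      using \<open>p \<noteq> 0\<close> by (simp add: field_simps)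
    hence "(1 - z / p) ^ n = (z - p) ^ n / (- p) ^ n"
      by (simp only: power_divide)
    thus ?thesis
      by (simp add: g_def)
  qed
  have "g analytic_on {p}"
    unfolding g_def by (intro analytic_intros h)
  then obtain A where A: "open A" "p \<in> A" "g holomorphic_on A"
    by (auto simp: analytic_at)
  have gp: "g p \<noteq> 0"
    using h(2) \<open>p \<noteq> 0\<close> by (simp add: g_def)
  obtain D where D: "open D" "p \<in> D" "\<And>z. z \<in> D \<Longrightarrow> z \<noteq> p \<Longrightarrow> F z = g z / (z - p) ^ n"
    using ev unfolding eq eventually_at_topological by blast
  have "is_pole (\<lambda>z. g z / (z - p) ^ n) p"
    by (rule is_pole_basic[OF A(3,1,2) gp \<open>n > 0\<close>])
  thus "is_pole F p"
    using is_pole_cong[OF ev refl] by (simp add: eq)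
  show "zorder F p = - int n"
  proof (rule zorder_eqI[of "A \<inter> D" _ g])
    show "g holomorphic_on A \<inter> D"
      using A(3) by (rule holomorphic_on_subset) auto
  qed (use A D gp in \<open>auto simp: power_int_minus divide_inverse\<close>)
qed

text \<open>Removing the singularity of the product with \<open>(1 - z / p) ^ Suc m\<close> gives an
  analytic numerator with value \<open>C\<close>. Allowing \<open>C = 0\<close> treats lower orders
  with the same \<open>m\<close>; the second claim, read contrapositively, gives
  \<open>C = 0\<close> at non-dominant points.\<close>

lemma meromorphic_principal_part:
  fixes F :: "complex \<Rightarrow> complex"
  assumes merom: "F meromorphic_on {p}" and "p \<noteq> 0"
    and lim: "(\<lambda>z. (1 - z / p) ^ Suc m * F z) \<midarrow>p\<rightarrow> C"
  shows "\<exists>c q. q analytic_on {p} \<and> c m = C \<and>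
      (\<forall>\<^sub>F z in at p. F z = (\<Sum>i\<le>m. c i / (1 - z / p) ^ Suc i) + q z)"
    and "C \<noteq> 0 \<Longrightarrow> is_pole F p \<and> zorder F p = - int (Suc m)"
proof -
  define K where "K = (\<lambda>z. (1 - z / p) ^ Suc m * F z)"
  have "K meromorphic_on {p}"
    unfolding K_def by (intro meromorphic_intros merom)
  hence iso: "isolated_singularity_at K p"
    by (rule meromorphic_on_isolated_singularity)
  define h where "h = remove_sings K"
  have h: "h analytic_on {p}" "h p = C"
    using remove_sings_analytic_at[OF iso] lim unfolding h_def K_def by auto
  have "\<forall>\<^sub>F z in at p. z \<noteq> p"
    by (simp add: eventually_at_filter)
  with eventually_remove_sings_eq_at[OF iso]
  have ev: "\<forall>\<^sub>F z in at p. F z = h z / (1 - z / p) ^ Suc m"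
    by eventually_elim (use \<open>p \<noteq> 0\<close> in \<open>auto simp: h_def K_def\<close>)
  obtain c q where cq: "q analytic_on {p}" "c m = h p"
    "\<forall>\<^sub>F z in at p. h z / (1 - z / p) ^ Suc m = (\<Sum>i\<le>m. c i / (1 - z / p) ^ Suc i) + q z"
    using analytic_over_power_partial_fraction[OF h(1) \<open>p \<noteq> 0\<close>, of m] by blast
  have "\<forall>\<^sub>F z in at p. F z = (\<Sum>i\<le>m. c i / (1 - z / p) ^ Suc i) + q z"
    using ev cq(3) by eventually_elim metis
  thus "\<exists>c q. q analytic_on {p} \<and> c m = C \<and>
      (\<forall>\<^sub>F z in at p. F z = (\<Sum>i\<le>m. c i / (1 - z / p) ^ Suc i) + q z)"
    using cq(1,2) h(2) by blast
  show "is_pole F p \<and> zorder F p = - int (Suc m)" if "C \<noteq> 0"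
    using pole_of_analytic_over_power[OF h(1) _ \<open>p \<noteq> 0\<close> zero_less_Suc ev] h(2) that by auto
qed

section \<open>Error terms\<close>

text \<open>For \<open>k > 0\<close> one has \<open>k + i \<le> Suc i * k\<close>, which bounds the
  falling product by a constant times \<open>k ^ i\<close>.\<close>

lemma binomial_add_bigo_power: "(\<lambda>k. real ((k + i) choose i)) \<in> O(\<lambda>k. real k ^ i)"
proof (rule bigoI)
  show "\<forall>\<^sub>F k in sequentially. norm (real ((k + i) choose i)) \<le> real (Suc i ^ i) * norm (real k ^ i)"
    using eventually_gt_at_top[of 0]
  proof eventually_elim
    case (elim k)
    have "(k + i) choose i \<le> ((k + i) choose i) * fact i"
      by simp
    also have "\<dots> \<le> (k + i) ^ i"
      by (rule binomial_fact_pow)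
    also have "\<dots> \<le> (Suc i * k) ^ i"
      using elim by (intro power_mono) (cases k, auto)
    finally have "real ((k + i) choose i) \<le> real ((Suc i * k) ^ i)"
      by (rule of_nat_mono)
    thus ?case
      by (simp only: power_mult_distrib of_nat_mult) simp
  qed
qed

text \<open>Induction by the absorption identity: the next error is a linear factor times the
  previous error plus \<open>k ^ Suc m / fact (Suc m)\<close>, and both are of the required
  order.\<close>

lemma binomial_add_minus_power_bigo:
  "(\<lambda>k. real ((k + Suc m) choose Suc m) - real k ^ Suc m / fact (Suc m)) \<in> O(\<lambda>k. real k ^ m)"
proof (induction m)
  case 0
  show ?case
    by simp
next
  case (Suc m)
  define b where "b = (\<lambda>k. real ((k + Suc m) choose Suc m))"
  have eq: "real ((k + Suc (Suc m)) choose Suc (Suc m)) - real k ^ Suc (Suc m) / fact (Suc (Suc m)) =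
      (real k + real (Suc (Suc m))) / real (Suc (Suc m)) * (b k - real k ^ Suc m / fact (Suc m)) +
      real k ^ Suc m / fact (Suc m)" for k
  proof -
    have "real (Suc (Suc m) * ((k + Suc (Suc m)) choose Suc (Suc m))) =
          real ((k + Suc (Suc m)) * ((k + Suc m) choose Suc m))"
      using Suc_times_binomial_eq[of "k + Suc m" "Suc m"] by (simp only: add_Suc_right mult.commute)
    hence "real ((k + Suc (Suc m)) choose Suc (Suc m)) =
           (real k + real (Suc (Suc m))) / real (Suc (Suc m)) * b k"
      unfolding of_nat_mult b_def by (simp add: field_simps del: binomial_Suc_Suc)
    moreover have "real k ^ Suc (Suc m) / fact (Suc (Suc m)) =
        (real k + real (Suc (Suc m))) / real (Suc (Suc m)) * (real k ^ Suc m / fact (Suc m)) -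
        real k ^ Suc m / fact (Suc m)"
      by (simp add: field_simps del: of_nat_Suc)
    ultimately show ?thesis
      by (simp only: right_diff_distrib)
  qed
  have "(\<lambda>k. (real k + real (Suc (Suc m))) / real (Suc (Suc m))) \<in> O(\<lambda>k. real k)"
    by real_asymp
  from landau_o.big.mult[OF this Suc.IH]
  have "(\<lambda>k. (real k + real (Suc (Suc m))) / real (Suc (Suc m)) * (b k - real k ^ Suc m / fact (Suc m)))
          \<in> O(\<lambda>k. real k ^ Suc m)"
    by (simp add: b_def)
  moreover have "(\<lambda>k. real k ^ Suc m / fact (Suc m)) \<in> O(\<lambda>k. real k ^ Suc m)"
    by simp
  ultimately show ?case
    unfolding eq by (rule sum_in_bigo(1))
qed

lemma bigo_of_real_norm_iff:
  fixes f :: "'a \<Rightarrow> complex" and a :: "'a \<Rightarrow> real"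
  shows "f \<in> O[F](\<lambda>k. complex_of_real (a k)) \<longleftrightarrow> (\<lambda>k. norm (f k)) \<in> O[F](a)"
  by (simp add: bigo_def)

text \<open>For \<open>m = 0\<close> the double sum is empty and only the decay \<open>R ^ k\<close>
  of \<open>g\<close> counts, hence the bound on \<open>\<epsilon>\<close>. For \<open>m > 0\<close>
  the terms of index \<open>i < m\<close> give at most \<open>k ^ (m - 1) / \<sigma> ^ k\<close>,
  which dominates \<open>g\<close> as well.\<close>

lemma coeff_remainder_bigo:
  fixes g :: "nat \<Rightarrow> complex"
  assumes \<sigma>: "\<sigma> > 0" and S: "S \<subseteq> sphere 0 \<sigma>"
    and g: "\<And>k. norm (g k) \<le> B / R ^ k" and \<epsilon>: "0 < \<epsilon>" "\<sigma> + \<epsilon> \<le> R"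
  shows "(\<lambda>k. g k + (\<Sum>p\<in>S. \<Sum>i<m. c p i * of_nat ((k + i) choose i) / p ^ k))
           \<in> O(\<lambda>k. complex_of_real (a_seq \<epsilon> \<sigma> (Suc m) k))"
proof (rule sum_in_bigo(1))
  have "B \<ge> 0"
    using g[of 0] norm_ge_zero[of "g 0"] by (simp del: norm_ge_zero)
  have g_le: "norm (g k) \<le> B * (1 / b ^ k)" if "0 < b" "b \<le> R" for k b
  proof -
    have "B / R ^ k \<le> B / b ^ k"
      using \<open>B \<ge> 0\<close> that by (intro divide_left_mono power_mono mult_pos_pos) auto
    thus ?thesis
      using g[of k] by simp
  qed
  show "g \<in> O(\<lambda>k. complex_of_real (a_seq \<epsilon> \<sigma> (Suc m) k))"
  proof (rule bigoI)
    show "\<forall>\<^sub>F k in sequentially. norm (g k) \<le> B * norm (complex_of_real (a_seq \<epsilon> \<sigma> (Suc m) k))"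
      using eventually_gt_at_top[of 0]
    proof eventually_elim
      case (elim k)
      show ?case
      proof (cases "m = 0")
        case True
        thus ?thesis
          using g_le[of "\<sigma> + \<epsilon>" k] \<epsilon> \<sigma> by (simp only: a_seq_def norm_of_real) simp
      next
        case False
        have "norm (g k) \<le> B * (1 / \<sigma> ^ k)"
          using \<epsilon> \<sigma> by (intro g_le) auto
        also have "\<dots> \<le> B * (real k ^ (m - 1) / \<sigma> ^ k)"
          using \<open>B \<ge> 0\<close> \<sigma> elim by (intro mult_left_mono divide_right_mono one_le_power) auto
        also have "real k ^ (m - 1) / \<sigma> ^ k = norm (complex_of_real (a_seq \<epsilon> \<sigma> (Suc m) k))"
          using False \<sigma> by (simp only: a_seq_def norm_of_real) simp
        finally show ?thesis .
      qed
    qed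
  qed
  show "(\<lambda>k. \<Sum>p\<in>S. \<Sum>i<m. c p i * of_nat ((k + i) choose i) / p ^ k)
          \<in> O(\<lambda>k. complex_of_real (a_seq \<epsilon> \<sigma> (Suc m) k))"
  proof (intro big_sum_in_bigo)
    fix p i assume p: "p \<in> S" and i: "i \<in> {..<m}"
    have "(\<lambda>k. real ((k + i) choose i)) \<in> O(\<lambda>k. real k ^ (m - 1))"
    proof (rule landau_o.big_trans[OF binomial_add_bigo_power bigoI])
      show "\<forall>\<^sub>F k in sequentially. norm (real k ^ i) \<le> 1 * norm (real k ^ (m - 1))"
        using eventually_gt_at_top[of 0]
        by eventually_elim (use i in \<open>auto intro!: power_increasing\<close>)
    qed
    from landau_o.big.mult[OF this landau_o.big_refl]
    have "(\<lambda>k. real ((k + i) choose i) * (1 / \<sigma> ^ k)) \<in> O(\<lambda>k. real k ^ (m - 1) * (1 / \<sigma> ^ k))" .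
    moreover have "(\<lambda>_. norm (c p i)) \<in> O(\<lambda>_::nat. 1)"
      by simp
    ultimately have "(\<lambda>k. norm (c p i) * (real ((k + i) choose i) * (1 / \<sigma> ^ k)))
             \<in> O(\<lambda>k. 1 * (real k ^ (m - 1) * (1 / \<sigma> ^ k)))"
      by (rule landau_o.big.mult[rotated])
    also have "(\<lambda>k. 1 * (real k ^ (m - 1) * (1 / \<sigma> ^ k))) = a_seq \<epsilon> \<sigma> (Suc m)"
      using i by (auto simp: a_seq_def)
    also have "(\<lambda>k. norm (c p i) * (real ((k + i) choose i) * (1 / \<sigma> ^ k))) =
               (\<lambda>k. norm (c p i * of_nat ((k + i) choose i) / p ^ k))"
      using p S by (auto simp: norm_mult norm_divide norm_power)
    finally show "(\<lambda>k. c p i * of_nat ((k + i) choose i) / p ^ k)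
        \<in> O(\<lambda>k. complex_of_real (a_seq \<epsilon> \<sigma> (Suc m) k))"
      by (simp only: bigo_of_real_norm_iff)
  qed
qed

text \<open>The error is negligible against the main term: geometrically for a simple pole, by a
  factor \<open>1 / k\<close> for higher order.\<close>

lemma a_seq_smallo:
  assumes "\<sigma> > 0" "\<epsilon> > 0"
  shows "a_seq \<epsilon> \<sigma> (Suc m) \<in> o(\<lambda>k. real k ^ m / \<sigma> ^ k)"
proof (rule smalloI_tendsto)
  show "\<forall>\<^sub>F k in sequentially. real k ^ m / \<sigma> ^ k \<noteq> 0"
    using eventually_gt_at_top[of 0] by eventually_elim (use assms in auto)
  show "(\<lambda>k. a_seq \<epsilon> \<sigma> (Suc m) k / (real k ^ m / \<sigma> ^ k)) \<longlonglongrightarrow> 0"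
  proof (cases m)
    case 0
    have "(\<lambda>k. (\<sigma> / (\<sigma> + \<epsilon>)) ^ k) \<longlonglongrightarrow> 0"
      using assms by (intro LIMSEQ_power_zero) auto
    thus ?thesis
      by (simp add: 0 a_seq_def power_divide)
  next
    case (Suc l)
    have "\<forall>\<^sub>F k in sequentially. inverse (real k) = a_seq \<epsilon> \<sigma> (Suc m) k / (real k ^ m / \<sigma> ^ k)"
      using eventually_gt_at_top[of 0]
      by eventually_elim (use assms in \<open>auto simp: Suc a_seq_def field_simps\<close>)
    with lim_inverse_n show ?thesis
      by (rule Lim_transform_eventually)
  qed
qed

text \<open>This passes from the binomial to the power form of the main term. For
  \<open>m = 0\<close> the two coincide, as they must: \<open>a_seq\<close> then decays faster than
  \<open>1 / \<sigma> ^ k\<close>.\<close>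

lemma binomial_minus_power_bigo_a_seq:
  assumes "\<sigma> > 0" and bound: "\<And>k. norm (\<xi> k) \<le> M"
  shows "(\<lambda>k. (of_nat ((k + m) choose m) - of_nat k ^ m / of_nat (fact m)) / complex_of_real \<sigma> ^ k * \<xi> k)
           \<in> O(\<lambda>k. complex_of_real (a_seq \<epsilon> \<sigma> (Suc m) k))"
proof (cases m)
  case 0
  thus ?thesis by simp
next
  case (Suc l)
  have \<xi>: "(\<lambda>k. norm (\<xi> k)) \<in> O(\<lambda>_. 1)"
    by (rule bigoI[of _ M]) (use bound in auto)
  have "(\<lambda>k. \<bar>real ((k + m) choose m) - real k ^ m / fact m\<bar> * (1 / \<sigma> ^ k) * norm (\<xi> k))
          \<in> O(\<lambda>k. real k ^ l * (1 / \<sigma> ^ k) * 1)"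
    unfolding Suc
    by (intro landau_o.big.mult landau_o.big_refl \<xi>)
       (simp only: landau_o.big.abs_in_iff binomial_add_minus_power_bigo)
  also have "(\<lambda>k. real k ^ l * (1 / \<sigma> ^ k) * 1) = a_seq \<epsilon> \<sigma> (Suc m)"
    by (auto simp: a_seq_def Suc)
  also have "(\<lambda>k. \<bar>real ((k + m) choose m) - real k ^ m / fact m\<bar> * (1 / \<sigma> ^ k) * norm (\<xi> k)) =
     (\<lambda>k. norm ((of_nat ((k + m) choose m) - of_nat k ^ m / of_nat (fact m)) / complex_of_real \<sigma> ^ k * \<xi> k))"
  proof
    fix k
    have "of_nat ((k + m) choose m) - of_nat k ^ m / of_nat (fact m) =
          complex_of_real (real ((k + m) choose m) - real k ^ m / fact m)"
      by simp
    thus "\<bar>real ((k + m) choose m) - real k ^ m / fact m\<bar> * (1 / \<sigma> ^ k) * norm (\<xi> k) =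
          norm ((of_nat ((k + m) choose m) - of_nat k ^ m / of_nat (fact m)) / complex_of_real \<sigma> ^ k * \<xi> k)"
      using assms(1) by (simp only: norm_mult norm_divide norm_of_real norm_power) simp
  qed
  finally show ?thesis
    by (simp only: bigo_of_real_norm_iff)
qed

section \<open>Coefficient asymptotics\<close>

theorem theoremA1:
  fixes x :: "nat \<Rightarrow> real" and \<sigma> :: real and F :: "complex \<Rightarrow> complex"
    and U :: "complex set" and mb P :: nat and s :: "nat \<Rightarrow> complex"
  assumes nonneg: "\<And>k. x k \<ge> 0"
    and infpos: "infinite {k. x k > 0}"
    and radius: "conv_radius (\<lambda>k. complex_of_real (x k)) = ereal \<sigma>"
    and sigma_pos: "\<sigma> > 0"
    and U_open: "open U" and U_sup: "cball 0 \<sigma> \<subseteq> U"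
    and merom: "F meromorphic_on U"
    and F_series: "\<And>z. norm z < \<sigma> \<Longrightarrow> F z = (\<Sum>k. complex_of_real (x k) * z ^ k)"
    and pole_sigma: "is_pole F (complex_of_real \<sigma>)"
    and order_sigma: "zorder F (complex_of_real \<sigma>) = - int mb"
    and mb_pos: "mb \<ge> 1"
    and P_pos: "P \<ge> 1"
    and dominant: "{z. dominant_pole F \<sigma> mb z} = s ` {..<P}"
    and s0: "s 0 = complex_of_real \<sigma>"
    and args: "\<And>i j. i < j \<Longrightarrow> j < P \<Longrightarrow> arg0 (s i) < arg0 (s j)"
  shows
    "(\<exists>\<epsilon>0>0. \<forall>\<epsilon>. 0 < \<epsilon> \<and> \<epsilon> \<le> \<epsilon>0 \<longrightarrow>
        (\<lambda>k. complex_of_real (x k)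
              - of_nat ((k + mb - 1) choose (mb - 1)) / complex_of_real \<sigma> ^ k * xi F \<sigma> s P mb k)
          \<in> O(\<lambda>k. complex_of_real (a_seq \<epsilon> \<sigma> mb k))
      \<and> (\<lambda>k. complex_of_real (x k)
              - of_nat k ^ (mb - 1) / of_nat (fact (mb - 1)) / complex_of_real \<sigma> ^ k * xi F \<sigma> s P mb k)
          \<in> O(\<lambda>k. complex_of_real (a_seq \<epsilon> \<sigma> mb k)))
     \<and> limsup (\<lambda>k. ereal (Re (xi F \<sigma> s P mb k))) > 0
     \<and> (\<forall>k. xi F \<sigma> s P mb k \<in> \<real> \<and> Re (xi F \<sigma> s P mb k) \<ge> 0)
     \<and> ((\<exists>N. \<forall>k\<ge>N. x (Suc k) \<le> x k) \<and> (\<forall>j<P. arg0 (s j) / pi \<in> \<rat>)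
          \<longrightarrow> (\<forall>k. Re (xi F \<sigma> s P mb k) > 0))"
proof -

  \<comment> \<open>Principal parts of \<open>F\<close> on the circle\<close>
  obtain m where m: "mb = Suc m"
    using mb_pos by (cases mb) auto
  have merom_at: "F meromorphic_on {p}" if "norm p \<le> \<sigma>" for p
    using merom U_sup that by (intro meromorphic_on_subset[OF merom]) auto
  have sums: "(\<lambda>k. complex_of_real (x k) * z ^ k) sums F z" if "norm z < \<sigma>" for z
    using F_series[OF that] summable_in_conv_radius[of z "\<lambda>k. complex_of_real (x k)"] that radius
    by (simp add: summable_sums)
  obtain L where L: "L \<noteq> 0"
    "(\<lambda>z. (1 - z / complex_of_real \<sigma>) ^ Suc m * F z) \<midarrow>complex_of_real \<sigma>\<rightarrow> L"
    using pole_imp_tendsto_nonzero[of F "of_real \<sigma>" "Suc m"] merom_at[of "of_real \<sigma>"]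
      pole_sigma order_sigma sigma_pos m by auto
  \<comment> \<open>\<open>Lim\<close> is a total operator, so convergence to \<open>C p\<close> has
    to be established, here at every point of the circle.\<close>
  define C where "C = (\<lambda>p. Lim (at p) (\<lambda>z. (1 - z / p) ^ Suc m * F z))"
  have C: "(\<lambda>z. (1 - z / p) ^ Suc m * F z) \<midarrow>p\<rightarrow> C p" if p: "norm p = \<sigma>" for p
  proof -
    obtain l where l: "(\<lambda>z. (1 - z / p) ^ Suc m * F z) \<midarrow>p\<rightarrow> l"
      using nonneg_powser_singularity_order_le[OF nonneg sigma_pos sums L(2) p merom_at] p by auto
    moreover have "C p = l"
      unfolding C_def by (rule tendsto_Lim[OF _ l]) simp
    ultimately show ?thesis
      by simp
  qed
  \<comment> \<open>Besides the dominant poles, \<open>S\<close> contains poles of lower order and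
    points where \<open>F\<close> merely takes a wrong value.\<close>
  define S where "S = {p \<in> sphere 0 \<sigma>. \<not> F analytic_on {p}}"
  have "finite (cball 0 \<sigma> \<inter> {w. \<not> F analytic_on {w}})"
    by (intro sparse_in_compact_finite meromorphic_on_imp_sparse_singularities
          meromorphic_on_subset[OF merom] U_sup compact_cball)
  hence fin_S: "finite S"
    by (rule finite_subset[rotated]) (auto simp: S_def)
  have S_sphere: "S \<subseteq> sphere 0 \<sigma>"
    by (auto simp: S_def)
  have S_norm: "norm p = \<sigma>" "p \<noteq> 0" if "p \<in> S" for p
    using that sigma_pos by (auto simp: S_def)
  define principal where "principal = (\<lambda>p c q. q analytic_on {p} \<and> c m = C p \<and>
      (\<forall>\<^sub>F z in at p. F z = (\<Sum>i\<le>m. c i / (1 - z / p) ^ Suc i) + q z))"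
  have "\<exists>c q. principal p c q" if "p \<in> S" for p
    unfolding principal_def using S_norm[OF that]
    by (intro meromorphic_principal_part(1)[OF merom_at _ C]) auto
  then obtain c q where "\<And>p. p \<in> S \<Longrightarrow> principal p (c p) (q p)"
    by metis
  hence q: "\<And>p. p \<in> S \<Longrightarrow> q p analytic_on {p}"
    and c_top: "\<And>p. p \<in> S \<Longrightarrow> c p m = C p"
    and pp: "\<And>p. p \<in> S \<Longrightarrow> \<forall>\<^sub>F z in at p. F z = (\<Sum>i\<le>m. c p i / (1 - z / p) ^ Suc i) + q p z"
    unfolding principal_def by blast+
  have ball_an: "F analytic_on ball 0 \<sigma>"
  proof -
    have "F holomorphic_on ball 0 \<sigma>"
      by (rule power_series_holomorphic[of 0 \<sigma> "\<lambda>k. complex_of_real (x k)"]) (use sums in auto)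
    thus ?thesis
      by (simp add: analytic_on_open)
  qed
  have an: "F analytic_on {z}" if "z \<in> cball 0 \<sigma> - S" for z
  proof (cases "norm z < \<sigma>")
    case True
    thus ?thesis
      by (intro analytic_on_subset[OF ball_an]) auto
  qed (use that in \<open>auto simp: S_def\<close>)
  obtain R g B where R: "R > \<sigma>" and gB: "\<And>k. norm (g k) \<le> B / R ^ k"
    and x_eq: "\<And>k. complex_of_real (x k) =
                  g k + (\<Sum>p\<in>S. \<Sum>i\<le>m. c p i * of_nat ((k + i) choose i) / p ^ k)"
    using coeffs_from_principal_parts[OF sigma_pos fin_S S_sphere sums an q pp] by blast

  \<comment> \<open>Leading terms and the two expansions in (a)\<close>
  define \<xi> where "\<xi> = (\<lambda>k. \<Sum>j<P. (complex_of_real \<sigma> / s j) ^ k * C (s j))"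
  have xi: "xi F \<sigma> s P mb = \<xi>"
    by (rule ext) (simp add: xi_def \<xi>_def C_def m)
  have s_dom: "norm (s j) = \<sigma>" "is_pole F (s j)" if "j < P" for j
  proof -
    have "s j \<in> {z. dominant_pole F \<sigma> mb z}"
      using that by (subst dominant) auto
    thus "norm (s j) = \<sigma>" "is_pole F (s j)"
      by (auto simp: dominant_pole_def)
  qed
  have inj: "inj_on s {..<P}"
  proof (rule linorder_inj_onI)
    fix i j assume "i < j" "j \<in> {..<P}"
    thus "s i \<noteq> s j"
      using args[of i j] by auto
  qed auto
  have sub: "s ` {..<P} \<subseteq> S"
    using s_dom analytic_at_imp_no_pole by (auto simp: S_def)
  \<comment> \<open>Points of \<open>S\<close> that are not dominant poles have
    \<open>C p = 0\<close>, so including them does not change the sum.\<close>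
  have xi_S: "\<xi> k = (\<Sum>p\<in>S. (complex_of_real \<sigma> / p) ^ k * c p m)" for k
  proof -
    have "\<xi> k = (\<Sum>p\<in>s ` {..<P}. (complex_of_real \<sigma> / p) ^ k * C p)"
      unfolding \<xi>_def by (simp add: sum.reindex[OF inj])
    also have "\<dots> = (\<Sum>p\<in>S. (complex_of_real \<sigma> / p) ^ k * C p)"
    proof (rule sum.mono_neutral_left[OF fin_S sub], intro ballI)
      fix p assume p: "p \<in> S - s ` {..<P}"
      hence "\<not> dominant_pole F \<sigma> mb p"
        using dominant by blast
      hence "C p = 0"
        using meromorphic_principal_part(2)[OF merom_at _ C, of p] S_norm[of p] p
        by (auto simp: dominant_pole_def m)
      thus "(complex_of_real \<sigma> / p) ^ k * C p = 0"
        by simp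
    qed
    finally show ?thesis
      by (simp add: c_top)
  qed
  \<comment> \<open>The terms with \<open>i = m\<close> add up to the main term, which leaves
    \<open>g\<close> and the indices below \<open>m\<close>.\<close>
  have E1_eq: "complex_of_real (x k) - of_nat ((k + m) choose m) / complex_of_real \<sigma> ^ k * \<xi> k =
      g k + (\<Sum>p\<in>S. \<Sum>i<m. c p i * of_nat ((k + i) choose i) / p ^ k)" for k
  proof -
    have "of_nat ((k + m) choose m) / complex_of_real \<sigma> ^ k * \<xi> k =
          (\<Sum>p\<in>S. c p m * of_nat ((k + m) choose m) / p ^ k)"
      unfolding xi_S sum_distrib_left using sigma_pos
      by (intro sum.cong) (auto simp: power_divide)
    thus ?thesis
      by (simp add: x_eq lessThan_Suc_atMost[symmetric] sum.distrib)
  qed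
  have \<xi>_bound: "norm (\<xi> k) \<le> (\<Sum>j<P. norm (C (s j)))" for k
    unfolding \<xi>_def
  proof (rule sum_norm_le)
    fix j assume "j \<in> {..<P}"
    thus "norm ((complex_of_real \<sigma> / s j) ^ k * C (s j)) \<le> norm (C (s j))"
      using s_dom(1)[of j] sigma_pos by (simp add: norm_mult norm_power norm_divide)
  qed
  have E1: "(\<lambda>k. complex_of_real (x k) - of_nat ((k + m) choose m) / complex_of_real \<sigma> ^ k * \<xi> k)
              \<in> O(\<lambda>k. complex_of_real (a_seq \<epsilon> \<sigma> (Suc m) k))"
    if "0 < \<epsilon>" "\<epsilon> \<le> R - \<sigma>" for \<epsilon>
    unfolding E1_eq using that by (intro coeff_remainder_bigo[OF sigma_pos S_sphere gB]) auto
  have E2: "(\<lambda>k. complex_of_real (x k) - of_nat k ^ m / of_nat (fact m) / complex_of_real \<sigma> ^ k * \<xi> k)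
              \<in> O(\<lambda>k. complex_of_real (a_seq \<epsilon> \<sigma> (Suc m) k))"
    if "0 < \<epsilon>" "\<epsilon> \<le> R - \<sigma>" for \<epsilon>
    using sum_in_bigo(1)[OF E1[OF that] binomial_minus_power_bigo_a_seq[where \<xi> = \<xi>, OF sigma_pos \<xi>_bound]]
    by (simp add: algebra_simps diff_divide_distrib)

  \<comment> \<open>Normalised coefficients and the claims (b), (c), (d)\<close>
  have asymp: "(\<lambda>k. complex_of_real (x k * \<sigma> ^ k / real k ^ m) - \<xi> k / of_real (fact m)) \<longlonglongrightarrow> 0"
  proof -
    have "(\<lambda>k. norm (complex_of_real (x k) - of_nat k ^ m / of_nat (fact m) / complex_of_real \<sigma> ^ k * \<xi> k))
            \<in> O(a_seq (R - \<sigma>) \<sigma> (Suc m))"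
      using E2[of "R - \<sigma>"] R by (simp only: bigo_of_real_norm_iff)
    hence "(\<lambda>k. norm (complex_of_real (x k) - of_nat k ^ m / of_nat (fact m) / complex_of_real \<sigma> ^ k * \<xi> k))
            \<in> o(\<lambda>k. real k ^ m / \<sigma> ^ k)"
      by (rule landau_o.big_small_trans[OF _ a_seq_smallo[OF sigma_pos]]) (use R in simp)
    hence "(\<lambda>k. norm (complex_of_real (x k) - of_nat k ^ m / of_nat (fact m) / complex_of_real \<sigma> ^ k * \<xi> k)
              / (real k ^ m / \<sigma> ^ k)) \<longlonglongrightarrow> 0"
      by (rule smalloD_tendsto)
    thus ?thesis
    proof (rule Lim_null_comparison[rotated])
      show "\<forall>\<^sub>F k in sequentially. norm (complex_of_real (x k * \<sigma> ^ k / real k ^ m) - \<xi> k / of_real (fact m))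
        \<le> norm (complex_of_real (x k) - of_nat k ^ m / of_nat (fact m) / complex_of_real \<sigma> ^ k * \<xi> k)
              / (real k ^ m / \<sigma> ^ k)"
        using eventually_gt_at_top[of 0]
      proof eventually_elim
        case (elim k)
        have "complex_of_real (x k * \<sigma> ^ k / real k ^ m) - \<xi> k / of_real (fact m) =
          (complex_of_real (x k) - of_nat k ^ m / of_nat (fact m) / complex_of_real \<sigma> ^ k * \<xi> k)
              / complex_of_real (real k ^ m / \<sigma> ^ k)"
          using elim sigma_pos by (simp add: field_simps)
        also have "norm \<dots> =
            norm (complex_of_real (x k) - of_nat k ^ m / of_nat (fact m) / complex_of_real \<sigma> ^ k * \<xi> k)
              / (real k ^ m / \<sigma> ^ k)"
          using sigma_pos by (simp only: norm_divide norm_of_real) simp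
        finally show ?case
          by simp
      qed
    qed
  qed
  have u: "norm (complex_of_real \<sigma> / s j) = 1" if "j < P" for j
    using s_dom(1)[OF that] sigma_pos by (simp add: norm_divide)
  have u0: "complex_of_real \<sigma> / s 0 = 1"
    using s0 sigma_pos by simp
  have u_neq: "complex_of_real \<sigma> / s j \<noteq> 1" if "0 < j" "j < P" for j
  proof
    assume "complex_of_real \<sigma> / s j = 1"
    hence "s j = s 0"
      using s0 by (auto simp: divide_eq_1_iff)
    thus False
      using args[OF that] by simp
  qed
  have C0: "C (s 0) \<noteq> 0"
  proof -
    have "C (s 0) = L"
      unfolding C_def s0 by (rule tendsto_Lim[OF _ L(2)]) simp
    thus ?thesis
      using L(1) by simp
  qed
  \<comment> \<open>The placeholder stands for positivity of the constant \<open>fact m\<close> that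
    plays the part of \<open>a\<close>; it is discharged at each use.\<close>
  note facts = u P_pos u0 u_neq C0 nonneg sigma_pos _ asymp[unfolded \<xi>_def]
  have b: "limsup (\<lambda>k. ereal (Re (\<xi> k))) > 0"
    unfolding \<xi>_def by (rule unit_exponential_sum_limsup_pos[OF facts]) auto
  have c: "\<xi> k \<in> \<real> \<and> Re (\<xi> k) \<ge> 0" for k
    unfolding \<xi>_def by (rule unit_exponential_sum_nonneg[OF facts]) auto
  have d: "Re (\<xi> k) > 0" if "\<exists>N. \<forall>k\<ge>N. x (Suc k) \<le> x k" for k
    unfolding \<xi>_def
    by (rule unit_exponential_sum_pos[OF facts]) (use that in \<open>auto simp: eventually_sequentially\<close>)
  show ?thesis
    unfolding xi unfolding m
    \<comment> \<open>The threshold \<open>R - \<sigma>\<close> serves as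
      \<open>\<epsilon>0\<close>, since it keeps \<open>\<sigma> + \<epsilon>\<close> at most
      \<open>R\<close>.\<close>
    using E1 E2 R b c d by (intro conjI exI[of _ "R - \<sigma>"]) auto
qed

end
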